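(* Let $G$ be a group acting on a finite set $X$, and let $\tau,\eta\in\mathrm{End}_G(X)$ be elementary collapsings (each of some type). Then $\tau\sim_{\mathcal{R}}\eta$ if and only if $\tau$ and $\eta$ miss the same orbit in their image, i.e. there is $z\in X$ such that $\mathrm{Im}(\tau)=X\setminus Gz=\mathrm{Im}(\eta)$.
   Context: $\mathrm{End}_G(X)$ is the monoid, under composition $(fg)(x)=f(g(x))$, of all $G$-equivariant functions $X\to X$. Write $S=\mathrm{End}_G(X)$. For $a,b\in S$, $a\sim_{\mathcal{R}} b$ means $aS=bS$, where $aS=\{as : s\in S\}$. $G_x$ is the stabilizer and $Gx$ the orbit of $x$. The kernel of $f:X\to X$ is $\ker(f)=\{(x,y)\in X\times X : f(x)=f(y)\}$. For a subgroup $K\le G$ and a subset $N\subseteq G$, $[K]_N=\{n^{-1}Kn : n\in N\}$; $N_H=N_G(H)$ is the normalizer of a subgroup $H\le G$. Definition. For subgroups $H,K\le G$, $\tau\in\mathrm{End}_G(X)$ is an elementary collapsing of type $(H,[K]_{N_H})$ if there exist $x,y\in X$ such that: (i) $Gx\neq Gy$; (ii) $G_x=H$; (iii) $[G_y]_{N_H}=[G_{\tau(x)}]_{N_H}=[K]_{N_H}$; (iv) $\ker(\tau)=\{(a,a): a\in X\}\cup\{(g\cdot x,g\cdot y),(g\cdot y,g\cdot x): g\in G\}\cup\{(g\cdot x,h\cdot x),(h\cdot x,g\cdot x): g,h\in G,\ h^{-1}g\in G_y\}$. When $X$ is finite, the image of any elementary collapsing is the complement of exactly one $G$-orbit (the "missed"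 orbit). *)

theory Defs
  imports "HOL-Algebra.Group_Action"
begin

text \<open>Maps \<open>X \<rightarrow> X\<close> are taken to be extensional (undefined outside the carrier \<open>X\<close>), as in
  \<^const>\<open>BijGroup\<close>, so that equality of HOL functions is equality of maps on \<open>X\<close>.\<close>

definition equivariant_End ::
    "('g, 'm) monoid_scheme \<Rightarrow> 'x set \<Rightarrow> ('g \<Rightarrow> 'x \<Rightarrow> 'x) \<Rightarrow> ('x \<Rightarrow> 'x) monoid" where
  "equivariant_End G X \<phi> =
    \<lparr>carrier = {f \<in> X \<rightarrow>\<^sub>E X. \<forall>g\<in>carrier G. \<forall>x\<in>X. f (\<phi> g x) = \<phi> g (f x)},
     mult = compose X,
     one = (\<lambda>x\<in>X. x)\<rparr>"

lemma (in group_action) monoid_equivariant_End: "monoid (equivariant_End G E \<phi>)"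
proof -
  have cl: "\<phi> g x \<in> E" if "g \<in> carrier G" "x \<in> E" for g x
    using element_image that by blast
  show ?thesis
    by (rule monoidI)
      (auto simp: equivariant_End_def compose_def cl restrict_def fun_eq_iff PiE_def Pi_def
        extensional_def)
qed

definition R_related :: "('a, 'm) monoid_scheme \<Rightarrow> 'a \<Rightarrow> 'a \<Rightarrow> bool" where
  "R_related M a b \<longleftrightarrow> a <#\<^bsub>M\<^esub> carrier M = b <#\<^bsub>M\<^esub> carrier M"

definition conjugates_by :: "('g, 'm) monoid_scheme \<Rightarrow> 'g set \<Rightarrow> 'g set \<Rightarrow> 'g set set" where
  "conjugates_by G N K = {(inv\<^bsub>G\<^esub> n <#\<^bsub>G\<^esub> K) #>\<^bsub>G\<^esub> n | n. n \<in> N}"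

definition map_kernel :: "'x set \<Rightarrow> ('x \<Rightarrow> 'y) \<Rightarrow> ('x \<times> 'x) set" where
  "map_kernel X f = {(x, y) \<in> X \<times> X. f x = f y}"

text \<open>The type \<open>(H, [K])\<close> of a collapsing is given by \<open>H\<close> and a representative \<open>K\<close> of the
  class; the definition depends on \<open>K\<close> only through its \<open>N\<^sub>G(H)\<close>-conjugates.\<close>

definition elementary_collapsing ::
    "('g, 'm) monoid_scheme \<Rightarrow> 'x set \<Rightarrow> ('g \<Rightarrow> 'x \<Rightarrow> 'x) \<Rightarrow> 'g set \<Rightarrow> 'g set \<Rightarrow> ('x \<Rightarrow> 'x) \<Rightarrow> bool"
  where
  "elementary_collapsing G X \<phi> H K \<tau> \<longleftrightarrow>
    subgroup H G \<and> subgroup K G \<and> \<tau> \<in> carrier (equivariant_End G X \<phi>) \<and>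
    (\<exists>x\<in>X. \<exists>y\<in>X.
      orbit G \<phi> x \<noteq> orbit G \<phi> y \<and>
      stabilizer G \<phi> x = H \<and>
      conjugates_by G (normalizer G H) (stabilizer G \<phi> y) =
        conjugates_by G (normalizer G H) (stabilizer G \<phi> (\<tau> x)) \<and>
      conjugates_by G (normalizer G H) (stabilizer G \<phi> (\<tau> x)) =
        conjugates_by G (normalizer G H) K \<and>
      map_kernel X \<tau> =
        {(a, a) | a. a \<in> X} \<union>
        (\<Union>g\<in>carrier G. {(\<phi> g x, \<phi> g y), (\<phi> g y, \<phi> g x)}) \<union>
        (\<Union>g\<in>carrier G. \<Union>h\<in>{h \<in> carrier G. inv\<^bsub>G\<^esub> h \<otimes>\<^bsub>G\<^esub> g \<in> stabilizer G \<phi> y}.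
          {(\<phi> g x, \<phi> h x), (\<phi> h x, \<phi> g x)}))"

end

theory Submission
  imports Defs
begin

text \<open>
  An elementary collapsing of a finite \<open>X\<close> that collapses the orbit of \<open>x\<close> is injective on the
  complement of that orbit and already attains its whole image there. It hence induces a bijection
  from all orbits but one onto the orbits inside its image, so the image misses exactly one orbit.
  If \<open>f\<close> and \<open>h\<close> have the same image and \<open>h\<close> is injective on an invariant set \<open>Y\<close> with
  \<open>h ` Y = h ` X\<close>, then \<open>f = h \<circ> s\<close> for \<open>s = (h|\<^sub>Y)\<^sup>-\<^sup>1 \<circ> f\<close>, and \<open>s\<close> is equivariant because
  preimages in \<open>Y\<close> are unique.
\<close>

section \<open>Equivariant maps and images of related elements\<close>

lemma mult_equivariant_End [simp]: "mult (equivariant_End G X \<phi>) = compose X"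
  by (simp add: equivariant_End_def)

lemma equivariant_EndD:
  assumes "f \<in> carrier (equivariant_End G X \<phi>)"
  shows "f \<in> extensional X"
    and "\<And>u. u \<in> X \<Longrightarrow> f u \<in> X"
    and "\<And>g u. g \<in> carrier G \<Longrightarrow> u \<in> X \<Longrightarrow> f (\<phi> g u) = \<phi> g (f u)"
  using assms by (auto simp: equivariant_End_def PiE_def)

text \<open>As the identity is in the monoid, each map lies in its own principal right ideal. It
  therefore factors through the other map, and a composite \<open>b \<circ> s\<close> has its image
  inside that of \<open>b\<close>.\<close>

lemma R_related_image_eq:
  assumes "monoid (equivariant_End G X \<phi>)"
    and "f \<in> carrier (equivariant_End G X \<phi>)" "h \<in> carrier (equivariant_End G X \<phi>)"
    and "R_related (equivariant_End G X \<phi>) f h"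
  shows "f ` X = h ` X"
proof -
  let ?S = "equivariant_End G X \<phi>"
  have image_sub: "a ` X \<subseteq> b ` X"
    if a: "a \<in> carrier ?S" and ab: "a <#\<^bsub>?S\<^esub> carrier ?S = b <#\<^bsub>?S\<^esub> carrier ?S" for a b
  proof -
    have "a \<in> a <#\<^bsub>?S\<^esub> carrier ?S"
      using monoid.r_one[OF assms(1) a] monoid.one_closed[OF assms(1)]
      unfolding l_coset_def by force
    then obtain s where s: "s \<in> carrier ?S" "a = compose X b s"
      unfolding ab by (auto simp: l_coset_def)
    show ?thesis
      using equivariant_EndD(2)[OF s(1)] by (auto simp: s(2) compose_def)
  qed
  show ?thesis
    using image_sub assms(2-4) unfolding R_related_def by (metis subset_antisym)
qed

section \<open>Factoring through a map injective on an invariant set\<close>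

context group_action
begin

lemma equivariant_End_factor:
  assumes f: "f \<in> carrier (equivariant_End G E \<phi>)"
    and h: "h \<in> carrier (equivariant_End G E \<phi>)"
    and Y: "Y \<subseteq> E" "\<And>g u. g \<in> carrier G \<Longrightarrow> u \<in> Y \<Longrightarrow> \<phi> g u \<in> Y"
    and inj: "inj_on h Y"
    and im: "f ` E \<subseteq> h ` Y"
  shows "\<exists>s\<in>carrier (equivariant_End G E \<phi>). f = compose E h s"
proof
  define s where "s = (\<lambda>u\<in>E. inv_into Y h (f u))"
  have s: "s u \<in> Y" "h (s u) = f u" if "u \<in> E" for u
    using that im by (auto simp: s_def inv_into_into f_inv_into_f image_subset_iff)
  have "s (\<phi> g u) = \<phi> g (s u)" if g: "g \<in> carrier G" and u: "u \<in> E" for g u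
  \<comment> \<open>Both sides lie in \<open>Y\<close>, and \<open>h\<close> sends both to
    \<open>\<phi> g (f u)\<close>.\<close>
  proof (rule inj_onD[OF inj])
    have "\<phi> g u \<in> E"
      using element_image g u by blast
    then show "s (\<phi> g u) \<in> Y" "h (s (\<phi> g u)) = h (\<phi> g (s u))"
      using s g u Y(1) equivariant_EndD(3)[OF f] equivariant_EndD(3)[OF h] by (auto simp: subset_iff)
    show "\<phi> g (s u) \<in> Y"
      using Y(2) s(1) g u by blast
  qed
  moreover have "s \<in> E \<rightarrow>\<^sub>E E"
    using s(1) Y(1) by (auto simp: s_def)
  ultimately show "s \<in> carrier (equivariant_End G E \<phi>)"
    by (simp add: equivariant_End_def)
  \<comment> \<open>Outside \<open>E\<close> both sides are \<open>undefined\<close>, since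
    \<open>f\<close> is extensional.\<close>
  show "f = compose E h s"
    using s(2) equivariant_EndD(1)[OF f] by (auto simp: compose_def restrict_def extensional_def fun_eq_iff)
qed

text \<open>Once \<open>f = h s\<close>, associativity turns each \<open>f t\<close> into
  \<open>h (s t)\<close>. Used in both directions, this gives equality of the principal right
  ideals.\<close>

lemma l_coset_equivariant_End_mono:
  assumes "f \<in> carrier (equivariant_End G E \<phi>)"
    and h: "h \<in> carrier (equivariant_End G E \<phi>)"
    and "Y \<subseteq> E" "\<And>g u. g \<in> carrier G \<Longrightarrow> u \<in> Y \<Longrightarrow> \<phi> g u \<in> Y"
    and "inj_on h Y"
    and "f ` E \<subseteq> h ` Y"
  shows "f <#\<^bsub>equivariant_End G E \<phi>\<^esub> carrier (equivariant_End G E \<phi>)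
    \<subseteq> h <#\<^bsub>equivariant_End G E \<phi>\<^esub> carrier (equivariant_End G E \<phi>)"
proof -
  let ?S = "equivariant_End G E \<phi>"
  interpret S: monoid ?S
    by (rule monoid_equivariant_End)
  obtain s where s: "s \<in> carrier ?S" and f: "f = h \<otimes>\<^bsub>?S\<^esub> s"
    using equivariant_End_factor[OF assms] by auto
  have "f \<otimes>\<^bsub>?S\<^esub> t \<in> h <#\<^bsub>?S\<^esub> carrier ?S" if t: "t \<in> carrier ?S" for t
  proof -
    have "f \<otimes>\<^bsub>?S\<^esub> t = h \<otimes>\<^bsub>?S\<^esub> (s \<otimes>\<^bsub>?S\<^esub> t)"
      unfolding f using S.m_assoc h s t by blast
    then show ?thesis
      using S.m_closed s t unfolding l_coset_def by blast
  qed
  then show ?thesis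
    unfolding l_coset_def by blast
qed

section \<open>Orbits under equivariant maps\<close>

lemma orbit_eq_image: "orbit G \<phi> u = (\<lambda>g. \<phi> g u) ` carrier G"
  by (auto simp: orbit_def)

lemma orbit_subset: "u \<in> E \<Longrightarrow> orbit G \<phi> u \<subseteq> E"
  using element_image by (auto simp: orbit_def)

lemma orbit_eqI:
  assumes "u \<in> E" "v \<in> orbit G \<phi> u"
  shows "orbit G \<phi> v = orbit G \<phi> u"
proof -
  have "v \<in> E"
    using assms orbit_subset by blast
  then have "v \<in> orbit G \<phi> v \<inter> orbit G \<phi> u"
    using assms(2) orbit_refl by blast
  moreover have "orbit G \<phi> v \<in> orbits G E \<phi>" "orbit G \<phi> u \<in> orbits G E \<phi>"
    using \<open>v \<in> E\<close> assms(1) by (auto simp: orbits_def)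
  ultimately show ?thesis
    using disjoint_union by blast
qed

lemma image_orbit:
  assumes "f \<in> carrier (equivariant_End G E \<phi>)" "u \<in> E"
  shows "f ` orbit G \<phi> u = orbit G \<phi> (f u)"
  using equivariant_EndD(3)[OF assms(1) _ assms(2)] by (simp add: orbit_eq_image image_image)

text \<open>Acting by \<open>g\<close> stays in the same orbit, and orbits are equal or disjoint.
  This makes the complement of an orbit available as the invariant set \<open>Y\<close> of the
  factorization.\<close>

lemma Diff_orbit_invariant:
  assumes "x \<in> E" "g \<in> carrier G" "u \<in> E - orbit G \<phi> x"
  shows "\<phi> g u \<in> E - orbit G \<phi> x"
proof -
  have "\<phi> g u \<in> orbit G \<phi> u"
    using assms(2) by (auto simp: orbit_def)
  moreover have "\<phi> g u \<in> E" "u \<in> orbit G \<phi> u"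
    using assms element_image orbit_refl by auto
  ultimately show ?thesis
    using assms orbit_eqI[of u "\<phi> g u"] orbit_eqI[of x "\<phi> g u"] by auto
qed

section \<open>Elementary collapsings and the missed orbit\<close>

lemma elementary_collapsingE:
  assumes "elementary_collapsing G E \<phi> H K \<tau>"
  obtains x where "\<tau> \<in> carrier (equivariant_End G E \<phi>)" "x \<in> E"
    "inj_on \<tau> (E - orbit G \<phi> x)" "\<tau> ` (E - orbit G \<phi> x) = \<tau> ` E"
proof -
  from assms obtain x y where \<tau>: "\<tau> \<in> carrier (equivariant_End G E \<phi>)"
    and x: "x \<in> E" and y: "y \<in> E" and ne: "orbit G \<phi> x \<noteq> orbit G \<phi> y"
    and ker: "map_kernel E \<tau> =
        {(a, a) | a. a \<in> E} \<union>
        (\<Union>g\<in>carrier G. {(\<phi> g x, \<phi> g y), (\<phi> g y, \<phi> g x)}) \<union>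
        (\<Union>g\<in>carrier G. \<Union>h\<in>{h \<in> carrier G. inv\<^bsub>G\<^esub> h \<otimes>\<^bsub>G\<^esub> g \<in> stabilizer G \<phi> y}.
          {(\<phi> g x, \<phi> h x), (\<phi> h x, \<phi> g x)})"
    unfolding elementary_collapsing_def by blast
  have "inj_on \<tau> (E - orbit G \<phi> x)"
  proof (rule inj_onI)
    fix a b
    assume ab: "a \<in> E - orbit G \<phi> x" "b \<in> E - orbit G \<phi> x" "\<tau> a = \<tau> b"
    then have "(a, b) \<in> map_kernel E \<tau>"
      by (simp add: map_kernel_def)
    \<comment> \<open>Every non-diagonal pair of the kernel has a component
      \<open>\<phi> g x\<close>, hence one in the orbit of \<open>x\<close>.\<close>
    with ab(1,2) show "a = b"
      unfolding ker orbit_def by blast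
  qed
  moreover have "\<tau> a \<in> \<tau> ` (E - orbit G \<phi> x)" if a: "a \<in> E" for a
  proof (cases "a \<in> orbit G \<phi> x")
    case True
    then obtain g where g: "g \<in> carrier G" "a = \<phi> g x"
      by (auto simp: orbit_def)
    \<comment> \<open>The kernel glues the orbit of \<open>x\<close> to that of \<open>y\<close>, so
      each value on the former is also taken on the latter.\<close>
    then have "(\<phi> g x, \<phi> g y) \<in> map_kernel E \<tau>"
      unfolding ker by blast
    then have "\<tau> a = \<tau> (\<phi> g y)"
      using g by (simp add: map_kernel_def)
    moreover have "\<phi> g y \<in> E - orbit G \<phi> x"
      using Diff_orbit_invariant[OF x g(1)] orbit_eqI[OF x, of y] y ne by auto
    ultimately show ?thesis
      by blast
  qed (use a in blast)
  ultimately show thesis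
    using that[OF \<tau> x] by blast
qed

lemma image_eq_Diff_orbit:
  assumes fin: "finite E"
    and f: "f \<in> carrier (equivariant_End G E \<phi>)"
    and x: "x \<in> E"
    and inj: "inj_on f (E - orbit G \<phi> x)"
    and im: "f ` (E - orbit G \<phi> x) = f ` E"
  shows "\<exists>z\<in>E. f ` E = E - orbit G \<phi> z"
proof -
  let ?O = "orbits G E \<phi>"
  let ?P = "?O - {orbit G \<phi> x}"
  let ?I = "{A \<in> ?O. A \<subseteq> f ` E}"
  have orb: "orbit G \<phi> u \<in> ?O" if "u \<in> E" for u
    using that by (auto simp: orbits_def)
  have finO: "finite ?O"
    using fin by (simp add: orbits_def setcompr_eq_image)
  have P: "A \<subseteq> E - orbit G \<phi> x" if "A \<in> ?P" for A
  proof
    fix v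
    assume "v \<in> A"
    from that obtain u where u: "u \<in> E" "A = orbit G \<phi> u" "A \<noteq> orbit G \<phi> x"
      by (auto simp: orbits_def)
    show "v \<in> E - orbit G \<phi> x"
      using u \<open>v \<in> A\<close> orbit_subset[OF u(1)] orbit_eqI[OF u(1), of v] orbit_eqI[OF x, of v] by auto
  qed
  \<comment> \<open>Members of \<open>?P\<close> are subsets of a set on which \<open>f\<close> is
    injective, so equal images force equal orbits.\<close>
  have "inj_on ((`) f) ?P"
    using P inj by (meson inj_on_image_eq_iff inj_onI)
  moreover have "(`) f ` ?P = ?I"
  proof (intro equalityI subsetI)
    fix A
    assume "A \<in> (`) f ` ?P"
    then obtain u where "u \<in> E" "A = f ` orbit G \<phi> u"
      by (auto simp: orbits_def)
    then have "A \<in> ?O" "A \<subseteq> f ` E"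
      using image_orbit[OF f] orb[OF equivariant_EndD(2)[OF f]] orbit_subset by (simp, blast)
    then show "A \<in> ?I"
      by simp
  next
    fix A
    assume "A \<in> ?I"
    then obtain v where v: "v \<in> E" "A = orbit G \<phi> v" "A \<subseteq> f ` E"
      by (auto simp: orbits_def)
    \<comment> \<open>By \<open>im\<close>, a preimage of \<open>v\<close> can be chosen off the
      orbit of \<open>x\<close>, so that its orbit belongs to \<open>?P\<close>.\<close>
    then have "v \<in> f ` (E - orbit G \<phi> x)"
      using orbit_refl im by blast
    then obtain u where u: "u \<in> E" "u \<notin> orbit G \<phi> x" "v = f u"
      by blast
    then have "orbit G \<phi> u \<in> ?P"
      using orb orbit_refl by blast
    moreover have "A = f ` orbit G \<phi> u"
      using v u image_orbit[OF f] by simp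
    ultimately show "A \<in> (`) f ` ?P"
      by blast
  qed
  \<comment> \<open>\<open>?P\<close> is \<open>?O\<close> with one element removed and is in
    bijection with \<open>?I\<close>, so exactly one orbit is not contained in the image.\<close>
  ultimately have "card ?I = card ?P"
    by (metis card_image)
  moreover have "card ?O = Suc (card ?P)"
    using card.remove[OF finO orb[OF x]] .
  moreover have "card (?O - ?I) = card ?O - card ?I"
    by (rule card_Diff_subset) (use finO in auto)
  ultimately have "card (?O - ?I) = 1"
    by simp
  then obtain B where B: "?O - ?I = {B}"
    by (auto simp: card_1_singleton_iff)
  then have "B \<in> ?O"
    by blast
  then obtain z where z: "z \<in> E" "B = orbit G \<phi> z"
    by (auto simp: orbits_def)
  \<comment> \<open>The image is closed under the action: an orbit that meets it lies in it. Hence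
    being outside the image means lying in the single orbit \<open>B\<close>.\<close>
  have sub: "orbit G \<phi> u \<subseteq> f ` E" if "u \<in> f ` E" for u
    using that image_orbit[OF f] orbit_subset by blast
  have fE: "u \<in> E" if "u \<in> f ` E" for u
    using that equivariant_EndD(2)[OF f] by blast
  have "u \<in> f ` E \<longleftrightarrow> u \<notin> orbit G \<phi> z" if u: "u \<in> E" for u
  proof -
    have "u \<in> f ` E \<longleftrightarrow> orbit G \<phi> u \<in> ?I"
      using sub[of u] orb[OF u] orbit_refl[OF u] by blast
    also have "\<dots> \<longleftrightarrow> orbit G \<phi> u \<noteq> orbit G \<phi> z"
      using B z(2) orb[OF u] by blast
    also have "\<dots> \<longleftrightarrow> u \<notin> orbit G \<phi> z"
      using orbit_eqI[OF z(1), of u] orbit_refl[OF u] by auto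
    finally show ?thesis .
  qed
  then show ?thesis
    using z(1) fE by blast
qed

end

theorem corollary33:
  fixes G :: "('g, 'm) monoid_scheme"
    and X :: "'x set"
    and \<phi> :: "'g \<Rightarrow> 'x \<Rightarrow> 'x"
  assumes "group_action G X \<phi>"
    and "finite X"
    and "\<exists>H K. elementary_collapsing G X \<phi> H K \<tau>"
    and "\<exists>H K. elementary_collapsing G X \<phi> H K \<eta>"
  shows "R_related (equivariant_End G X \<phi>) \<tau> \<eta> \<longleftrightarrow>
    (\<exists>z\<in>X. \<tau> ` X = X - orbit G \<phi> z \<and> X - orbit G \<phi> z = \<eta> ` X)"
proof -
  interpret group_action G X \<phi>
    by (fact assms(1))
  obtain x where \<tau>: "\<tau> \<in> carrier (equivariant_End G X \<phi>)" and x: "x \<in> X"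
    and \<tau>_inj: "inj_on \<tau> (X - orbit G \<phi> x)" and \<tau>_im: "\<tau> ` (X - orbit G \<phi> x) = \<tau> ` X"
    using assms(3) elementary_collapsingE by metis
  obtain y where \<eta>: "\<eta> \<in> carrier (equivariant_End G X \<phi>)" and y: "y \<in> X"
    and \<eta>_inj: "inj_on \<eta> (X - orbit G \<phi> y)" and \<eta>_im: "\<eta> ` (X - orbit G \<phi> y) = \<eta> ` X"
    using assms(4) elementary_collapsingE by metis
  have "R_related (equivariant_End G X \<phi>) \<tau> \<eta> \<longleftrightarrow> \<tau> ` X = \<eta> ` X"
  proof
    assume "R_related (equivariant_End G X \<phi>) \<tau> \<eta>"
    then show "\<tau> ` X = \<eta> ` X"
      by (rule R_related_image_eq[OF monoid_equivariant_End \<tau> \<eta>])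
  next
    assume eq: "\<tau> ` X = \<eta> ` X"
    show "R_related (equivariant_End G X \<phi>) \<tau> \<eta>"
      unfolding R_related_def
    proof
      \<comment> \<open>Here \<tau> is factored through \<eta>, so the invariant set is the
        complement of the orbit that \<eta> collapses. The second inclusion swaps the roles.\<close>
      show "\<tau> <#\<^bsub>equivariant_End G X \<phi>\<^esub> carrier (equivariant_End G X \<phi>)
          \<subseteq> \<eta> <#\<^bsub>equivariant_End G X \<phi>\<^esub> carrier (equivariant_End G X \<phi>)"
        by (rule l_coset_equivariant_End_mono[OF \<tau> \<eta> Diff_subset Diff_orbit_invariant[OF y] \<eta>_inj])
          (simp_all add: \<eta>_im eq)
      show "\<eta> <#\<^bsub>equivariant_End G X \<phi>\<^esub> carrier (equivariant_End G X \<phi>)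
          \<subseteq> \<tau> <#\<^bsub>equivariant_End G X \<phi>\<^esub> carrier (equivariant_End G X \<phi>)"
        by (rule l_coset_equivariant_End_mono[OF \<eta> \<tau> Diff_subset Diff_orbit_invariant[OF x] \<tau>_inj])
          (simp_all add: \<tau>_im eq)
    qed
  qed
  \<comment> \<open>The point \<open>z\<close> found for \<tau> also serves \<eta> when the images
    agree; conversely, a common \<open>z\<close> forces equal images.\<close>
  then show ?thesis
    using image_eq_Diff_orbit[OF assms(2) \<tau> x \<tau>_inj \<tau>_im] by metis
qed

end
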